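(* Let $\Sigma\ni0$ be a set of execution modes and let $A_\sigma:\mathbb{R}^n\to\mathbb{R}^n$, $\sigma\in\Sigma$, be continuously differentiable maps for which there is a constant $L\ge0$ with $|A_\sigma(x+\Delta x)-A_\sigma(x)|\le L|\Delta x|$ for all $x,\Delta x\in\mathbb{R}^n$ and $\sigma\in\Sigma$. Consider the system $$x_{k+1}=A_{\sigma_k}(x_k)+w_k,\qquad x_0\in\mathbb{R}^n,\ \sigma_k\in\Sigma,\ w_k\in\mathbb{R}^n,\ k\in\mathbb{N}_0 .$$ Let $V:\mathbb{R}^n\to[0,\infty)$ be any function with the following properties: - (positive definite) $V(0)=0$ and $V(x)>0$ for all $x\ne0$; - (weakly subadditive) there is $\gamma\ge1$ such that $\sqrt{V(a+b)}\le\sqrt{V(a)}+\gamma\sqrt{V(b)}$ for all $a,b\in\mathbb{R}^n$; - (equivalent to norm) there are $c_1,c_2>0$ such that $c_1\sqrt{V(x)}\le|x|\le c_2\sqrt{V(x)}$ for all $x\in\mathbb{R}^n$. Let $\alpha,\beta$ and $\rho_\sigma$ ($\sigma\in\Sigma$) be real numbers with $$\rho_\sigma\ge\|A_\sigma\|_V:=\sup_{x\ne0}\sqrt{\frac{V(A_\sigma(x))}{V(x)}},\qquad \alpha\ge\frac{c_2}{c_1},\qquad \beta\ge\gamma\frac{c_2}{c_1}.$$ Then $$\bar v_{k+1}=\rho_{\sigma_k}\bar v_k+\beta|w_k|,\qquad \bar v_0=\alpha|x_0|$$ is a convergence rate abstraction for the system: for every $x_0\in\mathbb{R}^n$ and all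 sequences $(\sigma_k)$ in $\Sigma$ and $(w_k)$ in $\mathbb{R}^n$, one has $|x_k|\le\bar v_k$ for all $k\ge0$.
   Context: $\mathbb{N}_0=\{0,1,2,\dots\}$; $|\cdot|$ is the Euclidean norm on $\mathbb{R}^n$. The mode $\sigma_k=0$ is nominal execution of the controller in step $k$; $\sigma_k\ne0$ is any deviation from it. *)

theory Defs
  imports "HOL-Analysis.Analysis"
begin

definition continuously_differentiable ::
    "('a::real_normed_vector \<Rightarrow> 'b::real_normed_vector) \<Rightarrow> bool" where
  "continuously_differentiable f \<longleftrightarrow>
     (\<exists>f' :: 'a \<Rightarrow> 'a \<Rightarrow>\<^sub>L 'b.
        (\<forall>x. (f has_derivative blinfun_apply (f' x)) (at x)) \<and> continuous_on UNIV f')"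

(* Extended-real-valued, because the supremum may be infinite.  Requiring a real number to be an
   upper bound for it therefore includes the requirement that the supremum is finite. *)
definition induced_gain ::
    "('a::real_normed_vector \<Rightarrow> real) \<Rightarrow> ('a \<Rightarrow> 'a) \<Rightarrow> ereal" where
  "induced_gain V f = (SUP x\<in>{x. x \<noteq> 0}. ereal (sqrt (V (f x) / V x)))"

primrec trajectory ::
    "('m \<Rightarrow> 'a \<Rightarrow> 'a) \<Rightarrow> 'a::real_normed_vector \<Rightarrow> (nat \<Rightarrow> 'm) \<Rightarrow> (nat \<Rightarrow> 'a) \<Rightarrow> nat \<Rightarrow> 'a" where
  "trajectory A x0 \<sigma> w 0 = x0"
| "trajectory A x0 \<sigma> w (Suc k) = A (\<sigma> k) (trajectory A x0 \<sigma> w k) + w k"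

primrec abstraction ::
    "('m \<Rightarrow> real) \<Rightarrow> real \<Rightarrow> real \<Rightarrow> 'a::real_normed_vector \<Rightarrow> (nat \<Rightarrow> 'm) \<Rightarrow> (nat \<Rightarrow> 'a) \<Rightarrow> nat \<Rightarrow> real" where
  "abstraction \<rho> \<alpha> \<beta> x0 \<sigma> w 0 = \<alpha> * norm x0"
| "abstraction \<rho> \<alpha> \<beta> x0 \<sigma> w (Suc k) =
     \<rho> (\<sigma> k) * abstraction \<rho> \<alpha> \<beta> x0 \<sigma> w k + \<beta> * norm (w k)"

definition convergence_rate_abstraction ::
    "'m set \<Rightarrow> ('m \<Rightarrow> 'a::real_normed_vector \<Rightarrow> 'a) \<Rightarrow> ('m \<Rightarrow> real) \<Rightarrow> real \<Rightarrow> real \<Rightarrow> bool" where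
  "convergence_rate_abstraction \<Sigma> A \<rho> \<alpha> \<beta> \<longleftrightarrow>
     (\<forall>x0 \<sigma> w. (\<forall>k. \<sigma> k \<in> \<Sigma>) \<longrightarrow>
        (\<forall>k. norm (trajectory A x0 \<sigma> w k) \<le> abstraction \<rho> \<alpha> \<beta> x0 \<sigma> w k))"

end

theory Submission
  imports Defs
begin

text \<open>
  The quantity \<open>c\<^sub>2 * sqrt (V x\<^sub>k)\<close> dominates \<open>norm x\<^sub>k\<close> and obeys the abstraction recursion as an
  inequality: the modes contract it by \<open>\<rho>\<close>, and weak subadditivity splits off the disturbance.
  The gain only constrains \<open>A \<sigma>\<close> away from the origin; since it is finite and \<open>A \<sigma>\<close> is Lipschitz,
  letting \<open>x \<rightarrow> 0\<close> forces \<open>A \<sigma> 0 = 0\<close>.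
\<close>

lemma sqrt_le_induced_gain:
  fixes V :: "'a::real_normed_vector \<Rightarrow> real"
  assumes "induced_gain V f \<le> ereal r" and "x \<noteq> 0" and "V x > 0"
  shows "sqrt (V (f x)) \<le> r * sqrt (V x)"
proof -
  have "ereal (sqrt (V (f x) / V x)) \<le> induced_gain V f"
    unfolding induced_gain_def using assms(2) by (intro SUP_upper) simp
  then have "sqrt (V (f x) / V x) \<le> r"
    using assms(1) order_trans by fastforce
  then show ?thesis
    using assms(3) by (simp add: real_sqrt_divide pos_divide_le_eq)
qed

text \<open>The gain is a supremum of nonnegative quotients, and any basis vector shows that the
  index set is nonempty; an empty supremum in \<open>ereal\<close> would be -\<infinity>.\<close>

lemma induced_gain_bound_nonneg:
  fixes V :: "'a::euclidean_space \<Rightarrow> real"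
  assumes "induced_gain V f \<le> ereal r"
    and "\<And>x. V x \<ge> 0" and "\<And>x. x \<noteq> 0 \<Longrightarrow> V x > 0"
  shows "r \<ge> 0"
proof -
  obtain b :: 'a where b: "b \<in> Basis"
    using nonempty_Basis by blast
  then have "b \<noteq> 0"
    by auto
  then have "0 \<le> r * sqrt (V b)" and "V b > 0"
    using sqrt_le_induced_gain[OF assms(1)] assms(2)[of "f b"] assms(3)[of b]
    by (auto intro: order_trans[of 0 "sqrt (V (f b))"])
  then show ?thesis
    by (simp add: zero_le_mult_iff)
qed

lemma induced_gain_bound_imp_fixes_zero:
  fixes V :: "'a::euclidean_space \<Rightarrow> real"
  assumes gain: "induced_gain V f \<le> ereal r"
    and nonneg: "\<And>x. V x \<ge> 0" and pos: "\<And>x. x \<noteq> 0 \<Longrightarrow> V x > 0"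
    and c: "c\<^sub>1 > 0" "c\<^sub>2 > 0"
    and lower: "\<And>x. c\<^sub>1 * sqrt (V x) \<le> norm x"
    and upper: "\<And>x. norm x \<le> c\<^sub>2 * sqrt (V x)"
    and L: "L \<ge> 0" and lip: "\<And>x. norm (f x - f 0) \<le> L * norm x"
  shows "f 0 = 0"
proof -
  obtain b :: 'a where b: "b \<in> Basis"
    using nonempty_Basis by blast
  have r: "r \<ge> 0"
    using gain nonneg pos by (rule induced_gain_bound_nonneg)
  \<comment> \<open>\<open>L\<close> pays for moving from \<open>f 0\<close> to \<open>f x\<close>;
    \<open>c\<^sub>2 * r / c\<^sub>1\<close> bounds \<open>norm (f x)\<close> by passing from the
    norm to \<open>V\<close>, applying the gain, and passing back.\<close>
  define K where "K = L + c\<^sub>2 * r / c\<^sub>1"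
  have K: "K \<ge> 0"
    using L r c by (simp add: K_def)
  have bound: "norm (f 0) \<le> K * norm x" if "x \<noteq> 0" for x :: 'a
  proof -
    have "norm (f x) \<le> c\<^sub>2 * sqrt (V (f x))"
      by (rule upper)
    also have "\<dots> \<le> c\<^sub>2 * (r * sqrt (V x))"
      using sqrt_le_induced_gain[OF gain that pos[OF that]] c by simp
    also have "\<dots> \<le> c\<^sub>2 * (r * (norm x / c\<^sub>1))"
      using lower[of x] r c by (intro mult_left_mono) (simp_all add: field_simps)
    finally have "norm (f x) \<le> c\<^sub>2 * r / c\<^sub>1 * norm x"
      by simp
    moreover have "norm (f 0) \<le> norm (f x) + norm (f x - f 0)"
      by (metis norm_minus_commute norm_triangle_sub)
    ultimately show ?thesis
      using lip[of x] by (simp add: K_def algebra_simps)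
  qed
  have "norm (f 0) \<le> 0 + e" if e: "e > 0" for e
  proof -
    \<comment> \<open>The test point is a multiple of the unit vector \<open>b\<close> with norm
      \<open>e / (K + 1)\<close>. The added 1 keeps the quotient defined when
      \<open>K = 0\<close>.\<close>
    have "e / (K + 1) > 0"
      using e K by simp
    then have "norm (f 0) \<le> K * (e / (K + 1))"
      using bound[of "(e / (K + 1)) *\<^sub>R b"] nonzero_Basis[OF b] b e K by simp
    also have "\<dots> \<le> e"
      using e K by (simp add: field_simps)
    finally show ?thesis
      by simp
  qed
  then have "norm (f 0) \<le> 0"
    by (rule field_le_epsilon)
  then show ?thesis
    by simp
qed

theorem theorem6p3:
  fixes \<Sigma> :: "'m::zero set"
    and A :: "'m \<Rightarrow> real ^ 'n \<Rightarrow> real ^ 'n"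
    and V :: "real ^ 'n \<Rightarrow> real"
    and \<rho> :: "'m \<Rightarrow> real"
    and L \<gamma> c\<^sub>1 c\<^sub>2 \<alpha> \<beta> :: real
  assumes "0 \<in> \<Sigma>"
    and "\<And>\<sigma>. \<sigma> \<in> \<Sigma> \<Longrightarrow> continuously_differentiable (A \<sigma>)"
    and "L \<ge> 0"
    and "\<And>\<sigma> x \<Delta>x. \<sigma> \<in> \<Sigma> \<Longrightarrow> norm (A \<sigma> (x + \<Delta>x) - A \<sigma> x) \<le> L * norm \<Delta>x"
    and "\<And>x. V x \<ge> 0"
    and "V 0 = 0"
    and "\<And>x. x \<noteq> 0 \<Longrightarrow> V x > 0"
    and "\<gamma> \<ge> 1"
    and "\<And>a b. sqrt (V (a + b)) \<le> sqrt (V a) + \<gamma> * sqrt (V b)"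
    and "c\<^sub>1 > 0" and "c\<^sub>2 > 0"
    and "\<And>x. c\<^sub>1 * sqrt (V x) \<le> norm x"
    and "\<And>x. norm x \<le> c\<^sub>2 * sqrt (V x)"
    and "\<And>\<sigma>. \<sigma> \<in> \<Sigma> \<Longrightarrow> ereal (\<rho> \<sigma>) \<ge> induced_gain V (A \<sigma>)"
    and "\<alpha> \<ge> c\<^sub>2 / c\<^sub>1"
    and "\<beta> \<ge> \<gamma> * (c\<^sub>2 / c\<^sub>1)"
  shows "convergence_rate_abstraction \<Sigma> A \<rho> \<alpha> \<beta>"
proof -
  note V_nonneg = assms(5) and V_zero = assms(6) and V_pos = assms(7)
  note c = assms(10,11) and lower = assms(12) and upper = assms(13) and gain = assms(14)
  have \<rho>_nonneg: "\<rho> s \<ge> 0" if "s \<in> \<Sigma>" for s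
    using gain[OF that] V_nonneg V_pos by (rule induced_gain_bound_nonneg)
  have A_zero: "A s 0 = 0" if s: "s \<in> \<Sigma>" for s
    using gain[OF s] V_nonneg V_pos c lower upper assms(3)
  proof (rule induced_gain_bound_imp_fixes_zero)
    show "norm (A s x - A s 0) \<le> L * norm x" for x
      using assms(4)[OF s, of 0 x] by simp
  qed
  \<comment> \<open>The trajectory may hit the origin, where the gain says nothing; there both sides
    vanish.\<close>
  have A_gain: "sqrt (V (A s x)) \<le> \<rho> s * sqrt (V x)" if s: "s \<in> \<Sigma>" for s x
  proof (cases "x = 0")
    case True
    then show ?thesis
      by (simp add: A_zero[OF s] V_zero)
  next
    case False
    then show ?thesis
      using sqrt_le_induced_gain[OF gain[OF s]] V_pos by blast
  qed
  \<comment> \<open>This is the source of \<open>c\<^sub>2 / c\<^sub>1\<close> in the bounds on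
    \<alpha> and \<beta>: it is used once for the initial state and once for each
    disturbance.\<close>
  have scaled: "c\<^sub>2 * sqrt (V x) \<le> c\<^sub>2 / c\<^sub>1 * norm x" for x
    using lower[of x] c by (simp add: field_simps)
  \<comment> \<open>An induction on the norm itself would pay the factor
    \<open>c\<^sub>2 / c\<^sub>1\<close> on the state in every step; here it is paid only at the
    start.\<close>
  have main: "c\<^sub>2 * sqrt (V (trajectory A x0 \<sigma> w k)) \<le> abstraction \<rho> \<alpha> \<beta> x0 \<sigma> w k"
    if \<sigma>: "\<forall>k. \<sigma> k \<in> \<Sigma>" for x0 \<sigma> w k
  proof (induction k)
    case 0
    show ?case
      using scaled[of x0] mult_right_mono[OF assms(15), of "norm x0"] by simp
  next
    case (Suc k)
    define x where "x = trajectory A x0 \<sigma> w k"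
    have s: "\<sigma> k \<in> \<Sigma>"
      using \<sigma> by blast
    \<comment> \<open>The disturbance is the second summand, so \<gamma> falls on it and the state
      keeps the plain factor \<rho>.\<close>
    have "c\<^sub>2 * sqrt (V (A (\<sigma> k) x + w k))
        \<le> c\<^sub>2 * (sqrt (V (A (\<sigma> k) x)) + \<gamma> * sqrt (V (w k)))"
      using assms(9) c by (intro mult_left_mono) auto
    also have "\<dots> = c\<^sub>2 * sqrt (V (A (\<sigma> k) x)) + \<gamma> * (c\<^sub>2 * sqrt (V (w k)))"
      by (simp add: algebra_simps)
    also have "\<dots> \<le> c\<^sub>2 * (\<rho> (\<sigma> k) * sqrt (V x)) + \<gamma> * (c\<^sub>2 / c\<^sub>1 * norm (w k))"
      using A_gain[OF s] scaled c assms(8) by (intro add_mono mult_left_mono) auto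
    also have "\<dots> = \<rho> (\<sigma> k) * (c\<^sub>2 * sqrt (V x)) + \<gamma> * (c\<^sub>2 / c\<^sub>1) * norm (w k)"
      by (simp add: algebra_simps)
    \<comment> \<open>Nonnegativity of \<rho> allows the induction hypothesis to be multiplied by
      it.\<close>
    also have "\<dots> \<le> \<rho> (\<sigma> k) * abstraction \<rho> \<alpha> \<beta> x0 \<sigma> w k + \<beta> * norm (w k)"
      using Suc.IH \<rho>_nonneg[OF s] assms(16)
      by (intro add_mono mult_left_mono mult_right_mono) (auto simp: x_def)
    finally show ?case
      by (simp add: x_def)
  qed
  show ?thesis
    unfolding convergence_rate_abstraction_def
    using main upper order_trans by blast
qed

end
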